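(* $\mathfrak{se}\le\mathfrak e$.
   Context: The Specker–Eda number $\mathfrak{se}$ is the least cardinality of a subgroup $G\le\mathbb Z^\omega$ containing all unit vectors $e_n$ ($n\in\omega$) such that every group homomorphism $h:G\to\mathbb Z$ satisfies $h(e_n)=0$ for all but finitely many $n$. An $\omega$-valued predictor is a pair $\pi=(D_\pi,\langle\pi_n:n\in D_\pi\rangle)$ with $D_\pi\subseteq\omega$ infinite and $\pi_n:\omega^n\to\omega$; $\pi$ predicts $f\in\omega^\omega$ if $f(n)=\pi_n(f\restriction n)$ for all but finitely many $n\in D_\pi$. The evasion number $\mathfrak e$ is the least size of a family $\mathcal F\subseteq\omega^\omega$ such that no single predictor predicts all $f\in\mathcal F$. *)

theory Defs
  imports "HOL-Algebra.Product_Groups" "HOL-Algebra.Elementary_Groups"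
begin

unbundle cardinal_syntax

text \<open>Cardinals are cardinal orders in the sense of the library, compared across types by \<open>\<le>o\<close>.
  The least cardinality is determined up to \<open>=o\<close> for a nonempty family of sets; it is
  meaningless for the empty family.\<close>

definition least_cardinality :: "'a set set \<Rightarrow> 'a rel" where
  "least_cardinality \<A> = |SOME A. A \<in> \<A> \<and> (\<forall>B\<in>\<A>. |A| \<le>o |B| )|"

lemma least_cardinality_attained:
  assumes "\<A> \<noteq> {}"
  obtains A where "A \<in> \<A>" "least_cardinality \<A> = |A|" "\<And>B. B \<in> \<A> \<Longrightarrow> |A| \<le>o |B|"
proof -
  obtain r where r: "r \<in> card_of ` \<A>" "\<forall>r'\<in>card_of ` \<A>. r \<le>o r'"
    using exists_minim_Card_order[of "card_of ` \<A>"] assms card_of_Card_order by blast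
  then have "\<exists>A. A \<in> \<A> \<and> (\<forall>B\<in>\<A>. |A| \<le>o |B| )"
    by blast
  from someI_ex[OF this] show ?thesis
    using that[OF _ least_cardinality_def] by blast
qed

lemma least_cardinality_le: "B \<in> \<A> \<Longrightarrow> least_cardinality \<A> \<le>o |B|"
  by (metis empty_iff least_cardinality_attained)

definition Z_omega :: "(nat \<Rightarrow> int) monoid" where
  "Z_omega = product_group UNIV (\<lambda>_. integer_group)"

definition unit_vector :: "nat \<Rightarrow> nat \<Rightarrow> int" where
  "unit_vector n = (\<lambda>k. if k = n then 1 else 0)"

definition specker_eda_group :: "(nat \<Rightarrow> int) set \<Rightarrow> bool" where
  "specker_eda_group G \<longleftrightarrow>
     subgroup G Z_omega \<and> range unit_vector \<subseteq> G \<and>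
     (\<forall>h \<in> hom (Z_omega\<lparr>carrier := G\<rparr>) integer_group. finite {n. h (unit_vector n) \<noteq> 0})"

definition specker_eda_number :: "(nat \<Rightarrow> int) rel" where
  "specker_eda_number = least_cardinality {G. specker_eda_group G}"

text \<open>A predictor is a pair \<open>(D, \<pi>)\<close>.  An element of \<open>\<omega>\<^sup>n\<close> is a list of length \<open>n\<close>; only the values
  \<open>\<pi> n s\<close> with \<open>n \<in> D\<close> and \<open>length s = n\<close> matter.\<close>

type_synonym predictor = "nat set \<times> (nat \<Rightarrow> nat list \<Rightarrow> nat)"

definition is_predictor :: "predictor \<Rightarrow> bool" where
  "is_predictor = (\<lambda>(D, \<pi>). infinite D)"

definition predicts :: "predictor \<Rightarrow> (nat \<Rightarrow> nat) \<Rightarrow> bool" where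
  "predicts = (\<lambda>(D, \<pi>) f. finite {n \<in> D. f n \<noteq> \<pi> n (map f [0..<n])})"

definition evading_family :: "(nat \<Rightarrow> nat) set \<Rightarrow> bool" where
  "evading_family F \<longleftrightarrow> \<not> (\<exists>P. is_predictor P \<and> (\<forall>f\<in>F. predicts P f))"

definition evasion_number :: "(nat \<Rightarrow> nat) rel" where
  "evasion_number = least_cardinality {F. evading_family F}"

end

theory Submission
  imports Defs "HOL-Computational_Algebra.Primes"
begin

text \<open>
  A function \<open>f\<close> is coded by the vector \<open>x\<close> with \<open>x\<^sub>k = 2\<^bsup>(f 0 + 1) + \<dots> + (f (k-1) + 1)\<^esup>\<close>.  Given an
  evading family \<open>F\<close>, let \<open>G\<close> be generated by the unit vectors and all tails of coding vectors of
  members of \<open>F\<close>, divided by their leading coefficients.  For a homomorphism \<open>h\<close> on \<open>G\<close>, the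
  values \<open>b\<^sub>m\<close> of \<open>h\<close> at these tails satisfy \<open>b\<^sub>m = h(e\<^sub>m) + 2\<^bsup>f m + 1\<^esup> b\<^bsub>m+1\<^esub>\<close>.  If \<open>h(e\<^sub>m) \<noteq> 0\<close> for
  infinitely many \<open>m\<close>, then for infinitely many such \<open>m\<close> the 2-adic valuation of \<open>h(e\<^sub>m)\<close> is minimal
  among all later ones; there \<open>b\<^sub>m\<close> has the same valuation as \<open>h(e\<^sub>m)\<close>, so \<open>f (m - 1)\<close> can be read
  off from \<open>b\<^bsub>m-1\<^esub>\<close>, that is, from \<open>b\<^sub>0\<close> and the values of \<open>f\<close> below \<open>m - 1\<close>.  As \<open>b\<^sub>0\<close> takes only
  countably many values, a single predictor predicts all of \<open>F\<close>.
\<close>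

section \<open>Cardinality of generated subgroups\<close>

lemma card_of_Un_le_infinite:
  assumes "infinite C" "|A| \<le>o |C|" "|B| \<le>o |C|"
  shows "|A \<union> B| \<le>o |C|"
  using assms
  by (intro card_of_Un_ordLeq_infinite_Field card_of_Card_order) (simp_all add: Field_card_of)

lemma card_of_generate_le:
  assumes "group G" and A: "|A| \<le>o |B|" and B: "infinite B"
  shows "|generate G A| \<le>o |B|"
proof -
  interpret group G by fact
  \<comment> \<open>\<open>generate\<close> inverts generators only, so stage 0 collects the
    inverses and later stages just multiply; the closure is a countable union of sets no larger than
    \<open>B\<close>.\<close>
  define X where "X = rec_nat (insert \<one>\<^bsub>G\<^esub> (A \<union> m_inv G ` A))
    (\<lambda>_ Y. Y \<union> (\<lambda>(x, y). x \<otimes>\<^bsub>G\<^esub> y) ` (Y \<times> Y))"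
  have X0: "X 0 = insert \<one>\<^bsub>G\<^esub> (A \<union> m_inv G ` A)"
    and XS: "\<And>n. X (Suc n) = X n \<union> (\<lambda>(x, y). x \<otimes>\<^bsub>G\<^esub> y) ` (X n \<times> X n)"
    by (simp_all add: X_def)
  have X_mono: "X m \<subseteq> X n" if "m \<le> n" for m n
    using that by (rule lift_Suc_mono_le[rotated]) (auto simp: XS)
  have "|X n| \<le>o |B|" for n
  proof (induction n)
    case 0
    have "|{\<one>\<^bsub>G\<^esub>}| \<le>o |B|"
      using B by (simp add: card_of_singl_ordLeq infinite_imp_nonempty)
    moreover have "|m_inv G ` A| \<le>o |B|"
      using card_of_image A ordLeq_transitive by blast
    ultimately have "|{\<one>\<^bsub>G\<^esub>} \<union> (A \<union> m_inv G ` A)| \<le>o |B|"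
      using A B by (intro card_of_Un_le_infinite)
    then show ?case by (simp add: X0)
  next
    case (Suc n)
    have "|X n \<times> X n| \<le>o |B|"
      using Suc B by (intro card_of_Sigma_ordLeq_infinite) simp_all
    then have "|(\<lambda>(x, y). x \<otimes>\<^bsub>G\<^esub> y) ` (X n \<times> X n)| \<le>o |B|"
      using card_of_image ordLeq_transitive by blast
    then show ?case
      using Suc B by (simp add: XS card_of_Un_le_infinite)
  qed
  moreover have "|UNIV :: nat set| \<le>o |B|"
    using B by (simp add: infinite_iff_card_of_nat)
  ultimately have "|\<Union>n. X n| \<le>o |B|"
    using B by (intro card_of_UNION_ordLeq_infinite) auto
  moreover have "generate G A \<subseteq> (\<Union>n. X n)"
  proof
    fix x assume "x \<in> generate G A"
    then show "x \<in> (\<Union>n. X n)"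
    proof induction
      case one
      then show ?case using X0 by blast
    next
      case (incl a)
      then show ?case using X0 by blast
    next
      case (inv a)
      then show ?case using X0 by blast
    next
      case (eng a b)
      then obtain m n where "a \<in> X m" "b \<in> X n" by blast
      then have "a \<in> X (max m n)" "b \<in> X (max m n)"
        using X_mono[of m "max m n"] X_mono[of n "max m n"] by auto
      then have "a \<otimes>\<^bsub>G\<^esub> b \<in> X (Suc (max m n))"
        by (auto simp: XS)
      then show ?case by blast
    qed
  qed
  ultimately show ?thesis
    using card_of_mono1 ordLeq_transitive by blast
qed

section \<open>Future minima, prediction and evading families\<close>

text \<open>Beyond any \<open>m\<close>, a point of \<open>S\<close> where \<open>v\<close> is least
  among the points of \<open>S\<close> above \<open>m\<close> is such a minimum.\<close>

lemma infinite_future_minima: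
  fixes v :: "nat \<Rightarrow> nat"
  assumes "infinite S"
  shows "infinite {n \<in> S. \<forall>k\<in>S. n < k \<longrightarrow> v n \<le> v k}"
  unfolding infinite_nat_iff_unbounded
proof
  fix m
  obtain n0 where "n0 \<in> S \<and> m < n0"
    using assms by (auto simp: infinite_nat_iff_unbounded)
  then obtain n where n: "n \<in> S \<and> m < n" "\<And>k. k \<in> S \<and> m < k \<Longrightarrow> v n \<le> v k"
    using ex_has_least_nat[of "\<lambda>n. n \<in> S \<and> m < n" n0 v] by blast
  then show "\<exists>n>m. n \<in> {n \<in> S. \<forall>k\<in>S. n < k \<longrightarrow> v n \<le> v k}"
    by (intro exI[of _ n]) auto
qed

text \<open>The predictor follows a member of \<open>F\<close> of least colour among those compatible with the
  sequence seen so far; for a fixed target this colour is nondecreasing and bounded, so it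
  stabilises, and from then on the predictions are correct.\<close>

lemma countably_coloured_family_predicted:
  fixes c :: "(nat \<Rightarrow> nat) \<Rightarrow> nat"
  assumes D: "infinite D"
    and det: "\<And>f g n. \<lbrakk>f \<in> F; g \<in> F; c f = c g; n \<in> D; \<forall>k<n. f k = g k\<rbrakk> \<Longrightarrow> f n = g n"
  shows "\<not> evading_family F"
proof -
  define compat where "compat = (\<lambda>n s g. g \<in> F \<and> map g [0..<n] = s)"
  define guess where "guess = (\<lambda>n s. ARG_MIN c g. compat n s g)"
  have "predicts (D, \<lambda>n s. guess n s n) f" if f: "f \<in> F" for f
  proof -
    define g where "g = (\<lambda>n. guess n (map f [0..<n]))"
    have compat_iff: "compat n (map f [0..<n]) u \<longleftrightarrow> u \<in> F \<and> (\<forall>k<n. u k = f k)" for n u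
      by (auto simp: compat_def)
    have g: "g n \<in> F" "\<And>k. k < n \<Longrightarrow> g n k = f k" for n
      using arg_min_natI[of "compat n (map f [0..<n])" f c] f
      unfolding g_def guess_def compat_iff by blast+
    have g_min: "c (g n) \<le> c u" if "u \<in> F" "\<And>k. k < n \<Longrightarrow> u k = f k" for n u
      using arg_min_nat_le[of "compat n (map f [0..<n])" u c] that
      unfolding g_def guess_def compat_iff by blast
    have mono: "c (g m) \<le> c (g n)" if "m \<le> n" for m n
      using g_min[of "g n" m] g that by (meson less_le_trans)
    obtain N where N: "\<And>n. c (g n) \<le> c (g N)"
      using ex_has_greatest_nat[of "\<lambda>_. True" 0 "\<lambda>n. c (g n)" "Suc (c f)"]
        le_imp_less_Suc[OF g_min[OF f refl]] by blast
    have "f n = g n n" if "n \<in> D" "N \<le> n" for n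
    proof -
      have "c (g n) = c (g (Suc n))"
        using N[of "Suc n"] mono[of N n] mono[of n "Suc n"] that(2) by simp
      \<comment> \<open>The stable colour may differ from that of \<open>f\<close>, so
        \<open>det\<close> is applied to two successive guesses; \<open>g (Suc n)\<close> already
        agrees with \<open>f\<close> at \<open>n\<close>.\<close>
      then have "g n n = g (Suc n) n"
        using g that(1) det[of "g n" "g (Suc n)" n] by simp
      then show ?thesis using g(2)[of n "Suc n"] by simp
    qed
    then have "{n \<in> D. f n \<noteq> g n n} \<subseteq> {..<N}"
      using leI by blast
    then have "finite {n \<in> D. f n \<noteq> g n n}"
      by (rule finite_subset) simp
    then show ?thesis
      by (simp add: predicts_def g_def)
  qed
  then show ?thesis
    using D unfolding evading_family_def is_predictor_def by blast
qed

text \<open>Makes the evasion number meaningful. Diagonalization: \<open>f\<close> always exceeds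
  the predicted value by one, where \<open>s n\<close> is the list of its first \<open>n\<close>
  values.\<close>

lemma evading_family_UNIV: "evading_family UNIV"
  unfolding evading_family_def
proof clarify
  fix D \<pi>
  assume D: "is_predictor (D, \<pi>)" and P: "\<forall>f\<in>UNIV. predicts (D, \<pi>) f"
  define s where "s = rec_nat [] (\<lambda>n t. t @ [Suc (\<pi> n t)])"
  define f where "f = (\<lambda>n. Suc (\<pi> n (s n)))"
  have "map f [0..<n] = s n" for n
    by (induction n) (simp_all add: s_def f_def)
  then have "{n \<in> D. f n \<noteq> \<pi> n (map f [0..<n])} = D"
    by (auto simp: f_def)
  then show False
    using D bspec[OF P UNIV_I, of f] by (simp add: is_predictor_def predicts_def)
qed

text \<open>An injective colouring makes determinacy trivial. The use is that \<open>F\<close> is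
  infinite, so countably many vectors per function cost nothing in cardinality.\<close>

lemma evading_family_uncountable:
  assumes "evading_family F"
  shows "uncountable F"
proof
  assume "countable F"
  then have "\<not> evading_family F"
    by (intro countably_coloured_family_predicted[of UNIV F "to_nat_on F"]) auto
  with assms show False by blast
qed

section \<open>2-adic valuations along the recurrence\<close>

text \<open>If all later \<open>h\<close>-values are divisible by \<open>2\<^sup>v\<close>, unfolding the recurrence \<open>v\<close> times shows the
  same for the later \<open>b\<close>-values, so \<open>b n\<close> and \<open>h n\<close> agree modulo \<open>2\<^bsup>v+1\<^esup>\<close>.\<close>

lemma multiplicity_eq_at_future_minimum:
  fixes h b :: "nat \<Rightarrow> int"
  assumes b: "\<And>k. b k = h k + 2 ^ Suc (f k) * b (Suc k)"
    and hn: "h n \<noteq> 0"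
    and min: "\<And>k. \<lbrakk>n < k; h k \<noteq> 0\<rbrakk> \<Longrightarrow> multiplicity 2 (h n) \<le> multiplicity 2 (h k)"
  shows "b n \<noteq> 0" and "multiplicity 2 (b n) = multiplicity 2 (h n)"
proof -
  define v where "v = multiplicity 2 (h n)"
  have h_dvd: "2 ^ j dvd h k" if "n < k" "j \<le> v" for j k
    using min[OF that(1)] that(2) multiplicity_dvd'[of j 2 "h k"] unfolding v_def by fastforce
  have b_dvd: "2 ^ j dvd b k" if "n < k" "j \<le> v" for j k
    using that
  proof (induction j arbitrary: k)
    case (Suc j)
    then have "2 ^ Suc j dvd 2 ^ Suc (f k) * b (Suc k)"
      by (simp add: mult.assoc)
    moreover have "2 ^ Suc j dvd h k"
      using h_dvd[OF Suc.prems] .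
    ultimately show ?case
      by (subst b) (rule dvd_add)
  qed simp
  have "2 ^ v dvd b (Suc n)" using b_dvd by simp
  then have D: "2 ^ Suc v dvd 2 ^ Suc (f n) * b (Suc n)"
    by (simp add: mult.assoc)
  have "\<not> 2 ^ Suc v dvd h n"
    unfolding v_def using hn by (simp add: power_dvd_iff_le_multiplicity del: power_Suc)
  then have nd: "\<not> 2 ^ Suc v dvd b n"
    using D by (subst b) (simp only: dvd_add_left_iff not_False_eq_True)
  then show "b n \<noteq> 0" by auto
  have "2 ^ v dvd b n"
    using power_le_dvd[OF D, of v]
    by (subst b) (intro dvd_add, simp_all add: v_def multiplicity_dvd)
  with nd show "multiplicity 2 (b n) = multiplicity 2 (h n)"
    unfolding v_def[symmetric] by (intro multiplicity_eqI) auto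
qed

text \<open>Cancelling powers of 2 gives \<open>b m = b' m\<close> up to \<open>n\<close>. At
  \<open>Suc n\<close> both sequences have the valuation of \<open>h (Suc n)\<close>, so comparing
  valuations in the recurrence at \<open>n\<close> leaves \<open>f n = f' n\<close>.\<close>

lemma digit_determined:
  fixes h b b' :: "nat \<Rightarrow> int"
  assumes b: "\<And>k. b k = h k + 2 ^ Suc (f k) * b (Suc k)"
    and b': "\<And>k. b' k = h k + 2 ^ Suc (f' k) * b' (Suc k)"
    and init: "b 0 = b' 0" and agree: "\<forall>k<n. f k = f' k"
    and hn: "h (Suc n) \<noteq> 0"
    and min: "\<And>k. \<lbrakk>Suc n < k; h k \<noteq> 0\<rbrakk> \<Longrightarrow> multiplicity 2 (h (Suc n)) \<le> multiplicity 2 (h k)"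
  shows "f n = f' n"
proof -
  have "b m = b' m" if "m \<le> n" for m
    using that
  proof (induction m)
    case (Suc m)
    then have "2 ^ Suc (f m) * b (Suc m) = 2 ^ Suc (f m) * b' (Suc m)"
      using b[of m] b'[of m] agree by simp
    then show ?case by simp
  qed (simp add: init)
  then have eq: "2 ^ Suc (f n) * b (Suc n) = 2 ^ Suc (f' n) * b' (Suc n)"
    using b[of n] b'[of n] by simp
  have mult: "multiplicity 2 (2 ^ j * z) = j + multiplicity 2 z" if "z \<noteq> 0" for j and z :: int
    using that by (simp add: prime_elem_multiplicity_mult_distrib)
  have m: "b (Suc n) \<noteq> 0" "multiplicity 2 (b (Suc n)) = multiplicity 2 (h (Suc n))"
    using multiplicity_eq_at_future_minimum[of b h f "Suc n"] b hn min by blast+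
  have m': "b' (Suc n) \<noteq> 0" "multiplicity 2 (b' (Suc n)) = multiplicity 2 (h (Suc n))"
    using multiplicity_eq_at_future_minimum[of b' h f' "Suc n"] b' hn min by blast+
  show ?thesis
    using arg_cong[OF eq, of "multiplicity 2"] m m' by (simp add: mult del: power_Suc)
qed

section \<open>The subgroup generated by the coding vectors\<close>

lemma Z_omega_group: "group Z_omega"
  by (simp add: Z_omega_def)

lemma Z_omega_carrier [simp]: "carrier Z_omega = UNIV"
  by (simp add: Z_omega_def)

lemma Z_omega_mult [simp]: "x \<otimes>\<^bsub>Z_omega\<^esub> y = (\<lambda>k. x k + y k)"
  by (simp add: Z_omega_def restrict_def)

lemma Z_omega_one [simp]: "\<one>\<^bsub>Z_omega\<^esub> = (\<lambda>_. 0)"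
  by (simp add: Z_omega_def restrict_def)

text \<open>Needed to push \<open>h\<close> through the scalar in \<open>coding_vector_rec\<close>;
  multiples are iterated sums.\<close>

lemma hom_Z_omega_subgroup_scale:
  assumes G: "subgroup G Z_omega" and h: "h \<in> hom (Z_omega\<lparr>carrier := G\<rparr>) integer_group"
    and x: "x \<in> G"
  shows "(\<lambda>k. int n * x k) \<in> G \<and> h (\<lambda>k. int n * x k) = int n * h x"
proof (induction n)
  case 0
  interpret group_hom "Z_omega\<lparr>carrier := G\<rparr>" integer_group h
    using h group.subgroup_imp_group[OF Z_omega_group G]
    by (simp add: group_hom_def group_hom_axioms_def)
  show ?case
    using subgroup.one_closed[OF G] hom_one by simp
next
  case (Suc n)
  have "(\<lambda>k. int (Suc n) * x k) = x \<otimes>\<^bsub>Z_omega\<^esub> (\<lambda>k. int n * x k)"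
    by (simp add: algebra_simps)
  moreover have "x \<otimes>\<^bsub>Z_omega\<^esub> (\<lambda>k. int n * x k) \<in> G"
    using Suc x subgroup.m_closed[OF G] by blast
  moreover have "h (x \<otimes>\<^bsub>Z_omega\<^esub> (\<lambda>k. int n * x k)) = h x + int n * h x"
    using Suc x h by (simp add: hom_def)
  ultimately show ?case by (simp add: algebra_simps)
qed

text \<open>The tail from \<open>m\<close> on, normalized to have entry 1 at \<open>m\<close>.
  Because of \<open>Suc\<close>, each step contributes a factor 2 even where \<open>f\<close>
  vanishes, which the valuation argument relies on.\<close>

definition coding_vector :: "(nat \<Rightarrow> nat) \<Rightarrow> nat \<Rightarrow> nat \<Rightarrow> int" where
  "coding_vector f m = (\<lambda>k. if k < m then 0 else 2 ^ (\<Sum>j = m..<k. Suc (f j)))"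

lemma coding_vector_rec:
  "coding_vector f m =
    unit_vector m \<otimes>\<^bsub>Z_omega\<^esub> (\<lambda>k. int (2 ^ Suc (f m)) * coding_vector f (Suc m) k)"
proof
  fix k
  show "coding_vector f m k =
    (unit_vector m \<otimes>\<^bsub>Z_omega\<^esub> (\<lambda>k. int (2 ^ Suc (f m)) * coding_vector f (Suc m) k)) k"
    by (cases "m < k")
      (auto simp: coding_vector_def unit_vector_def sum.atLeast_Suc_lessThan power_add)
qed

lemma evading_family_specker_eda_group:
  assumes F: "evading_family F"
  obtains G where "specker_eda_group G" "|G| \<le>o |F|"
proof -
  have inf: "infinite F"
    using evading_family_uncountable[OF F] countable_finite by blast
  then have nat: "|UNIV :: nat set| \<le>o |F|"
    by (simp add: infinite_iff_card_of_nat)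
  define A where "A = range unit_vector \<union> case_prod coding_vector ` (F \<times> UNIV)"
  define G where "G = generate Z_omega A"
  have "|range unit_vector| \<le>o |F|"
    using card_of_image nat ordLeq_transitive by blast
  moreover have "|F \<times> (UNIV :: nat set)| \<le>o |F|"
    using inf nat
    by (intro card_of_Sigma_ordLeq_infinite) (simp_all add: card_of_refl ordIso_imp_ordLeq)
  then have "|case_prod coding_vector ` (F \<times> UNIV)| \<le>o |F|"
    using card_of_image ordLeq_transitive by blast
  ultimately have "|A| \<le>o |F|"
    unfolding A_def using inf by (intro card_of_Un_le_infinite)
  then have card: "|G| \<le>o |F|"
    unfolding G_def using inf by (intro card_of_generate_le Z_omega_group)
  have sub: "subgroup G Z_omega"
    unfolding G_def by (rule group.generate_is_subgroup[OF Z_omega_group]) simp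
  have unit: "unit_vector n \<in> G" for n
    unfolding G_def by (rule generate.incl) (simp add: A_def)
  have coding: "coding_vector f m \<in> G" if "f \<in> F" for f m
    unfolding G_def by (rule generate.incl) (use that in \<open>force simp: A_def\<close>)
  have "finite {n. h (unit_vector n) \<noteq> 0}"
    if h: "h \<in> hom (Z_omega\<lparr>carrier := G\<rparr>) integer_group" for h
  proof (rule ccontr)
    assume infS: "infinite {n. h (unit_vector n) \<noteq> 0}"
    define u where "u = (\<lambda>n. h (unit_vector n))"
    define R where "R = {n \<in> {n. u n \<noteq> 0}. \<forall>k\<in>{n. u n \<noteq> 0}.
      n < k \<longrightarrow> multiplicity 2 (u n) \<le> multiplicity 2 (u k)}"
    have "infinite R"
      unfolding R_def using infS by (intro infinite_future_minima) (simp add: u_def)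
    \<comment> \<open>The value \<open>f n\<close> is read off at \<open>Suc n\<close>, so the
      predictor works on the predecessors of \<open>R\<close>; only 0 is lost in the shift.\<close>
    moreover have "R \<subseteq> insert 0 (Suc ` {n. Suc n \<in> R})"
    proof
      fix n assume "n \<in> R"
      then show "n \<in> insert 0 (Suc ` {n. Suc n \<in> R})" by (cases n) auto
    qed
    ultimately have infD: "infinite {n. Suc n \<in> R}"
      using finite_subset by blast
    have rec: "h (coding_vector f m) = u m + 2 ^ Suc (f m) * h (coding_vector f (Suc m))"
      if f: "f \<in> F" for f m
    proof -
      note sc = hom_Z_omega_subgroup_scale[OF sub h coding[OF f], of "2 ^ Suc (f m)" "Suc m"]
      have "h (x \<otimes>\<^bsub>Z_omega\<^esub> y) = h x + h y" if "x \<in> G" "y \<in> G" for x y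
        using h that by (simp add: hom_def)
      from this[OF unit sc[THEN conjunct1], of m] sc[THEN conjunct2] show ?thesis
        unfolding coding_vector_rec[symmetric] by (simp add: u_def)
    qed
    \<comment> \<open>The colour of \<open>f\<close> is the integer
      \<open>h (coding_vector f 0)\<close>, encoded as a natural number; the values \<open>u\<close>
      depend on \<open>h\<close> alone.\<close>
    have "\<not> evading_family F"
    proof (rule countably_coloured_family_predicted[OF infD])
      fix f g n
      assume "f \<in> F" "g \<in> F"
        and c: "to_nat (h (coding_vector f 0)) = to_nat (h (coding_vector g 0))"
        and n: "n \<in> {n. Suc n \<in> R}" and agree: "\<forall>k<n. f k = g k"
      show "f n = g n"
        by (rule digit_determined[OF rec[OF \<open>f \<in> F\<close>] rec[OF \<open>g \<in> F\<close>] _ agree])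
          (use c n in \<open>auto simp: R_def\<close>)
    qed
    with F show False by blast
  qed
  then have "specker_eda_group G"
    unfolding specker_eda_group_def using sub unit by blast
  with card show ?thesis using that by blast
qed

theorem theorem2p1:
  shows "specker_eda_number \<le>o evasion_number"
proof -
  obtain F where F: "evading_family F" "evasion_number = |F|"
    using least_cardinality_attained[of "{F. evading_family F}"] evading_family_UNIV
    unfolding evasion_number_def by blast
  obtain G where G: "specker_eda_group G" "|G| \<le>o |F|"
    using evading_family_specker_eda_group[OF F(1)] .
  have "specker_eda_number \<le>o |G|"
    unfolding specker_eda_number_def using G(1) by (intro least_cardinality_le) simp
  with G(2) F(2) show ?thesis
    using ordLeq_transitive by metis
qed

end
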